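(* Let $p\ge 3$ and let $\phi:[0,\infty)\to\mathbb{R}$ be differentiable with $\phi(w)<p-2$ for all $w> 0$, and consider the estimator $\hat\theta_\phi(X)=\bigl(1-\phi(\|X\|^2)/\|X\|^2\bigr)X$. Assume: (A.1) $\phi'(w)\ge 0$ for all $w\ge 0$; (A.2) $\phi(w)\ge 0$ for all $w\ge 0$; (A.4) $\lim_{w\to\infty}\phi(w)=p-2$; (A.6) the function $w\mapsto w\phi'(w)/\{p-2-\phi(w)\}^2$ is monotone non-decreasing on $(0,\infty)$; (A.7) $R(0,\hat\theta_{\mathrm{JS}})\ge R(0,\hat\theta_\phi)$ (dominance at the origin). Then $\hat\theta_\phi$ dominates the James--Stein estimator, i.e. $R(\theta,\hat\theta_\phi)\le R(\theta,\hat\theta_{\mathrm{JS}})$ for all $\theta\in\mathbb{R}^p$.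
   Context: Let $X\sim\mathcal{N}_p(\theta,I_p)$ with $\theta\in\mathbb{R}^p$, $p\ge 3$. The loss is quadratic, and the risk of an estimator $\hat\theta$ is $R(\theta,\hat\theta)=\mathrm{E}_\theta[\|\hat\theta(X)-\theta\|^2]$. The James--Stein estimator is $\hat\theta_{\mathrm{JS}}(X)=\bigl(1-(p-2)/\|X\|^2\bigr)X$. For a function $\phi$ on $[0,\infty)$, $\hat\theta_\phi(X)=\bigl(1-\phi(\|X\|^2)/\|X\|^2\bigr)X$. *)

theory Defs
  imports "HOL-Probability.Probability"
begin

definition normal_density :: "real^'n \<Rightarrow> real^'n \<Rightarrow> real" where
  "normal_density \<theta> x =
     (2 * pi) powr (- real CARD('n) / 2) * exp (- (norm (x - \<theta>))\<^sup>2 / 2)"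

text \<open>Quadratic risk E_theta ||est(X) - theta||^2 for X ~ N_p(theta, I_p),
  as a nonnegative (extended real) integral, so it is always defined.\<close>
definition risk :: "real^'n \<Rightarrow> (real^'n \<Rightarrow> real^'n) \<Rightarrow> ennreal" where
  "risk \<theta> est = (\<integral>\<^sup>+ x. ennreal ((norm (est x - \<theta>))\<^sup>2 * normal_density \<theta> x) \<partial>lborel)"

definition phi_est :: "(real \<Rightarrow> real) \<Rightarrow> real^'n \<Rightarrow> real^'n" where
  "phi_est \<phi> x = (1 - \<phi> ((norm x)\<^sup>2) / (norm x)\<^sup>2) *\<^sub>R x"

definition js_est :: "real^'n \<Rightarrow> real^'n" where
  "js_est x = (1 - (real CARD('n) - 2) / (norm x)\<^sup>2) *\<^sub>R x"

end

theory Submission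
  imports Defs "HOL-Real_Asymp.Real_Asymp"
begin

text \<open>
  In polar coordinates the risk is an average over directions \<open>u\<close> of one-dimensional integrals over
  the rays \<open>r u\<close>, \<open>r > 0\<close>. On each ray, integrating the derivative of
  \<open>r^(p-2) \<delta>(r) exp (- r^2/2 + a r)\<close>, where \<open>\<delta>(r) = p - 2 - \<phi>(r^2)\<close> and \<open>a = u \<bullet> \<theta>\<close>, gives Stein's
  identity, so that the difference of the two risks becomes the integral of
  \<open>D(r) exp (- r^2/2 + a r)\<close> with
  \<open>D(r) = r^(p-3) \<delta>(r)^2 (4 w \<phi>'(w) / \<delta>(r)^2 - 1)\<close>, \<open>w = r^2\<close>.
  By (A.6), \<open>D\<close> changes sign at most once, from negative to positive, say at \<open>r0\<close>. Adding the
  rays \<open>u\<close> and \<open>- u\<close> replaces \<open>exp (a r)\<close> by \<open>2 cosh (a r)\<close>, which increases with \<open>r\<close>; hence the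
  sum is at least \<open>2 cosh (a r0)\<close> times the integral for \<open>\<theta> = 0\<close>, which is nonnegative by (A.7).
\<close>

subsection \<open>Integration along rays\<close>

lemma nn_integral_lborel_scaleR:
  fixes f :: "'a::euclidean_space \<Rightarrow> ennreal"
  assumes [measurable]: "f \<in> borel_measurable borel" and c: "c \<noteq> 0"
  shows "(\<integral>\<^sup>+x. f x \<partial>lborel) = ennreal (\<bar>c\<bar> ^ DIM('a)) * (\<integral>\<^sup>+x. f (c *\<^sub>R x) \<partial>lborel)"
  by (subst lborel_affine[OF c, of 0])
     (simp add: nn_integral_density nn_integral_distr nn_integral_cmult ennreal_power)

text \<open>The measure with this density has the surface measure of the unit sphere as its image
  under \<open>sgn\<close>, since 1/r integrates to 1 over [1, e]. Directions can thus be averaged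
  by a Lebesgue integral over the whole space.\<close>

definition direction_weight :: "'a::euclidean_space \<Rightarrow> real" where
  "direction_weight x = indicator {x. 1 \<le> norm x \<and> norm x \<le> exp 1} x / norm x ^ DIM('a)"

lemma direction_weight_nonneg: "0 \<le> direction_weight x"
  by (simp add: direction_weight_def)

lemma borel_measurable_direction_weight [measurable]:
  "direction_weight \<in> borel_measurable borel"
  unfolding direction_weight_def by measurable

lemma direction_weight_0 [simp]: "direction_weight 0 = 0"
  by (simp add: direction_weight_def)

text \<open>With \<open>m = norm y\<close>, the interval consists of the dilations
  \<open>t > 0\<close> that bring y/t into the shell; its mass under dt/t is ln e = 1.\<close>

lemma nn_integral_inverse_window:
  assumes "0 < (m::real)"
  shows "(\<integral>\<^sup>+t. ennreal (1 / t) * indicator {m / exp 1..m} t \<partial>lborel) = 1"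
proof -
  have pos: "0 < m / exp 1" using assms by simp
  have "m \<le> m * exp 1" using assms by simp
  then have le: "m / exp 1 \<le> m" by (simp add: field_simps)
  have "(\<integral>\<^sup>+t. ennreal (1 / t) * indicator {m / exp 1..m} t \<partial>lborel) = ennreal (ln m - ln (m / exp 1))"
    using pos le
    by (intro nn_integral_FTC_Icc) (auto intro!: derivative_eq_intros has_vector_derivative_at_within
        simp flip: has_real_derivative_iff_has_vector_derivative)
  then show ?thesis using assms by (simp add: ln_div)
qed

text \<open>Polar coordinates without a surface measure: averaging over dilations,
  \<open>\<integral> f = \<integral>\<integral> W(y/t) f(y) dt/t dy\<close> for the indicator \<open>W\<close> of the shell \<open>1 \<le> |x| \<le> e\<close>, because
  \<open>\<integral> W(y/t) dt/t = 1\<close>; then substitute \<open>y = t x\<close> and \<open>s = t |x|\<close>.\<close>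
lemma nn_integral_polar:
  fixes f :: "'a::euclidean_space \<Rightarrow> ennreal"
  assumes [measurable]: "f \<in> borel_measurable borel"
  shows "(\<integral>\<^sup>+x. f x \<partial>lborel) =
    (\<integral>\<^sup>+x. ennreal (direction_weight x) *
      (\<integral>\<^sup>+s. ennreal (s ^ (DIM('a) - 1)) * f (s *\<^sub>R sgn x) * indicator {0<..} s \<partial>lborel) \<partial>lborel)"
proof -
  let ?W = "\<lambda>x::'a. indicator {x. 1 \<le> norm x \<and> norm x \<le> exp 1} x :: ennreal"
  let ?n = "DIM('a)"
  have n: "0 < ?n" by simp
  have scale: "(\<integral>\<^sup>+y. ?W (y /\<^sub>R t) * f y \<partial>lborel) = ennreal (t ^ ?n) * (\<integral>\<^sup>+x. ?W x * f (t *\<^sub>R x) \<partial>lborel)"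
    if "0 < t" for t
    using that by (subst nn_integral_lborel_scaleR[of _ t]) auto
  have window: "(\<integral>\<^sup>+t. indicator {0<..} t * ennreal (1 / t) * ?W (y /\<^sub>R t) \<partial>lborel) = 1" if "y \<noteq> 0" for y
  proof -
    have "(\<integral>\<^sup>+t. indicator {0<..} t * ennreal (1 / t) * ?W (y /\<^sub>R t) \<partial>lborel)
        = (\<integral>\<^sup>+t. ennreal (1 / t) * indicator {norm y / exp 1..norm y} t \<partial>lborel)"
    proof (intro nn_integral_cong)
      fix t :: real
      have "0 < norm y / exp 1" using that by simp
      moreover have "1 \<le> norm (y /\<^sub>R t) \<and> norm (y /\<^sub>R t) \<le> exp 1 \<longleftrightarrow> norm y / exp 1 \<le> t \<and> t \<le> norm y" if "0 < t"
        using that by (auto simp: field_simps)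
      ultimately show "indicator {0<..} t * ennreal (1 / t) * ?W (y /\<^sub>R t) = ennreal (1 / t) * indicator {norm y / exp 1..norm y} t"
        by (cases "0 < t") (auto simp: indicator_def)
    qed
    then show ?thesis using nn_integral_inverse_window[of "norm y"] that by simp
  qed
  \<comment> \<open>The substitution s = t |x| produces the power of |x| by which
    \<open>direction_weight\<close> divides.\<close>
  have ray: "(\<integral>\<^sup>+t. indicator {0<..} t * ennreal (t ^ (?n - 1)) * (?W x * f (t *\<^sub>R x)) \<partial>lborel)
      = ennreal (direction_weight x) *
      (\<integral>\<^sup>+s. ennreal (s ^ (?n - 1)) * f (s *\<^sub>R sgn x) * indicator {0<..} s \<partial>lborel)" for x
  proof (cases "x = 0")
    case True
    then show ?thesis by (simp add: indicator_def)
  next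
    case False
    define m where "m = norm x"
    have m: "0 < m" using False by (simp add: m_def)
    have "(\<integral>\<^sup>+s. ennreal (s ^ (?n - 1)) * f (s *\<^sub>R sgn x) * indicator {0<..} s \<partial>lborel)
      = ennreal m * (\<integral>\<^sup>+t. ennreal ((m * t) ^ (?n - 1)) * f ((m * t) *\<^sub>R sgn x) * indicator {0<..} (m * t) \<partial>lborel)"
      using m by (subst nn_integral_real_affine[where c = m and t = 0]) auto
    also have "\<dots> = ennreal m * (\<integral>\<^sup>+t. ennreal (m ^ (?n - 1)) * (indicator {0<..} t * ennreal (t ^ (?n - 1)) * f (t *\<^sub>R x)) \<partial>lborel)"
    proof (intro arg_cong[where f = "(*) (ennreal m)"] nn_integral_cong)
      fix t :: real
      have "(m * t) *\<^sub>R sgn x = t *\<^sub>R x" using m by (simp add: m_def sgn_div_norm)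
      then show "ennreal ((m * t) ^ (?n - 1)) * f ((m * t) *\<^sub>R sgn x) * indicator {0<..} (m * t)
        = ennreal (m ^ (?n - 1)) * (indicator {0<..} t * ennreal (t ^ (?n - 1)) * f (t *\<^sub>R x))"
        using m by (auto simp: indicator_def power_mult_distrib ennreal_mult zero_less_mult_iff ac_simps)
    qed
    also have "\<dots> = ennreal (m ^ ?n) * (\<integral>\<^sup>+t. indicator {0<..} t * ennreal (t ^ (?n - 1)) * f (t *\<^sub>R x) \<partial>lborel)"
      using m power_eq_if[of m ?n] by (simp add: nn_integral_cmult ennreal_mult mult.assoc)
    finally have "ennreal (direction_weight x) *
      (\<integral>\<^sup>+s. ennreal (s ^ (?n - 1)) * f (s *\<^sub>R sgn x) * indicator {0<..} s \<partial>lborel)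
      = ennreal (direction_weight x * m ^ ?n) * (\<integral>\<^sup>+t. indicator {0<..} t * ennreal (t ^ (?n - 1)) * f (t *\<^sub>R x) \<partial>lborel)"
      using m by (simp add: ennreal_mult direction_weight_nonneg mult.assoc)
    also have "ennreal (direction_weight x * m ^ ?n) = ?W x"
      using m by (auto simp: direction_weight_def m_def indicator_def)
    finally show ?thesis
      by (simp add: nn_integral_cmult[symmetric] ac_simps)
  qed
  have "(\<integral>\<^sup>+y. f y \<partial>lborel) = (\<integral>\<^sup>+y. (\<integral>\<^sup>+t. indicator {0<..} t * ennreal (1 / t) * ?W (y /\<^sub>R t) \<partial>lborel) * f y \<partial>lborel)"
  \<comment> \<open>The window identity fails at the origin, which is a null set.\<close>
  proof (rule nn_integral_cong_AE)
    show "AE y in lborel. f y = (\<integral>\<^sup>+t. indicator {0<..} t * ennreal (1 / t) * ?W (y /\<^sub>R t) \<partial>lborel) * f y"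
      using AE_lborel_singleton[of "0::'a"] by eventually_elim (subst window, simp_all)
  qed
  also have "\<dots> = (\<integral>\<^sup>+y. (\<integral>\<^sup>+t. indicator {0<..} t * ennreal (1 / t) * (?W (y /\<^sub>R t) * f y) \<partial>lborel) \<partial>lborel)"
    by (simp add: nn_integral_multc[symmetric] mult.assoc)
  also have "\<dots> = (\<integral>\<^sup>+t. (\<integral>\<^sup>+y. indicator {0<..} t * ennreal (1 / t) * (?W (y /\<^sub>R t) * f y) \<partial>lborel) \<partial>lborel)"
    by (rule lborel_pair.Fubini') measurable
  also have "\<dots> = (\<integral>\<^sup>+t. (\<integral>\<^sup>+x. indicator {0<..} t * ennreal (t ^ (?n - 1)) * (?W x * f (t *\<^sub>R x)) \<partial>lborel) \<partial>lborel)"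
  proof (rule nn_integral_cong)
    fix t :: real
    show "(\<integral>\<^sup>+y. indicator {0<..} t * ennreal (1 / t) * (?W (y /\<^sub>R t) * f y) \<partial>lborel)
      = (\<integral>\<^sup>+x. indicator {0<..} t * ennreal (t ^ (?n - 1)) * (?W x * f (t *\<^sub>R x)) \<partial>lborel)"
    proof (cases "0 < t")
      case True
      \<comment> \<open>The measure dt/t lowers the Jacobian \<open>t ^ ?n\<close> of y = t x by one
        power.\<close>
      have "ennreal (1 / t) * ennreal (t ^ ?n) = ennreal (t ^ (?n - 1))"
        using True n power_eq_if[of t ?n] by (simp flip: ennreal_mult)
      then show ?thesis
        using True by (simp add: nn_integral_cmult scale) (simp flip: mult.assoc)
    qed (simp add: indicator_def)
  qed
  also have "\<dots> = (\<integral>\<^sup>+x. (\<integral>\<^sup>+t. indicator {0<..} t * ennreal (t ^ (?n - 1)) * (?W x * f (t *\<^sub>R x)) \<partial>lborel) \<partial>lborel)"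
    by (rule lborel_pair.Fubini') measurable
  finally show ?thesis
    by (simp only: ray)
qed

text \<open>Allows the total weight to be cancelled from an inequality. If it were 0, the polar
  formula for the constant 1 would make the whole space a null set; it is finite because the weight
  is at most 1 and supported in a ball.\<close>

lemma direction_weight_integral_pos_finite:
  "(\<integral>\<^sup>+x. ennreal (direction_weight (x::'a::euclidean_space)) \<partial>lborel) \<noteq> 0"
  "(\<integral>\<^sup>+x. ennreal (direction_weight (x::'a)) \<partial>lborel) \<noteq> \<infinity>"
proof -
  show "(\<integral>\<^sup>+x. ennreal (direction_weight (x::'a::euclidean_space)) \<partial>lborel) \<noteq> 0"
  proof
    assume "(\<integral>\<^sup>+x. ennreal (direction_weight (x::'a)) \<partial>lborel) = 0"
    then have "AE x::'a in lborel. ennreal (direction_weight x) = 0"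
      by (subst (asm) nn_integral_0_iff_AE) auto
    then have "(\<integral>\<^sup>+x. ennreal (direction_weight (x::'a)) *
      (\<integral>\<^sup>+s. ennreal (s ^ (DIM('a) - 1)) * 1 * indicator {0<..} s \<partial>lborel) \<partial>lborel) = (\<integral>\<^sup>+x. 0 \<partial>(lborel :: 'a measure))"
      by (intro nn_integral_cong_AE) auto
    then show False
      using nn_integral_polar[of "\<lambda>_::'a. 1"] by simp
  qed
  have "(\<integral>\<^sup>+x. ennreal (direction_weight (x::'a)) \<partial>lborel) \<le> (\<integral>\<^sup>+x. indicator (cball (0::'a) (exp 1)) x \<partial>lborel)"
    by (intro nn_integral_mono)
       (auto simp: direction_weight_def indicator_def divide_le_eq_1 one_le_power)
  also have "\<dots> = emeasure lborel (cball (0::'a) (exp 1))" by simp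
  also have "\<dots> < \<infinity>" by (intro emeasure_lborel_cball_finite)
  finally show "(\<integral>\<^sup>+x. ennreal (direction_weight (x::'a)) \<partial>lborel) \<noteq> \<infinity>" by simp
qed

subsection \<open>Gaussian integrals on the half-line\<close>

text \<open>For \<open>r > 0\<close> the bound r^k \<le> exp (k r) absorbs the power into the linear
  term; completing the square then leaves a multiple of a normal density with mean
  \<open>a + real k\<close>.\<close>

lemma set_integrable_power_gauss:
  "set_integrable lborel {0<..} (\<lambda>r. r ^ k * exp (- r\<^sup>2 / 2 + a * r :: real))"
proof -
  let ?m = "a + real k"
  have "integrable lborel (\<lambda>r. (exp (?m\<^sup>2 / 2) * sqrt (2 * pi)) * Distributions.normal_density ?m 1 r)"
    by (intro integrable_mult_right integrable_normal_density) simp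
  also have "(\<lambda>r. (exp (?m\<^sup>2 / 2) * sqrt (2 * pi)) * Distributions.normal_density ?m 1 r) = (\<lambda>r. exp (- r\<^sup>2 / 2 + ?m * r))"
    by (auto simp: fun_eq_iff Distributions.normal_density_def power2_eq_square field_simps simp flip: exp_add)
  finally have int: "integrable lborel (\<lambda>r. exp (- r\<^sup>2 / 2 + ?m * r))" .
  have bound: "r ^ k * exp (- r\<^sup>2 / 2 + a * r) \<le> exp (- r\<^sup>2 / 2 + ?m * r)" if "0 < r" for r :: real
  proof -
    have "r \<le> exp r" using exp_ge_add_one_self[of r] by linarith
    then have "r ^ k \<le> exp (real k * r)"
      using that by (simp add: exp_of_nat_mult power_mono)
    then have "r ^ k * exp (- r\<^sup>2 / 2 + a * r) \<le> exp (real k * r) * exp (- r\<^sup>2 / 2 + a * r)"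
      by (rule mult_right_mono) simp
    then show ?thesis by (simp add: algebra_simps flip: exp_add)
  qed
  show ?thesis
    unfolding set_integrable_def
    by (rule Bochner_Integration.integrable_bound[OF int]) (use bound in \<open>auto simp: indicator_def\<close>)
qed

lemma set_integrable_bounded_mult:
  fixes f g :: "real \<Rightarrow> real"
  assumes f: "set_integrable lborel S f" and [measurable]: "g \<in> borel_measurable borel"
    and B: "\<And>r. r \<in> S \<Longrightarrow> \<bar>g r\<bar> \<le> B"
  shows "set_integrable lborel S (\<lambda>r. g r * f r)"
proof -
  have [measurable]: "(\<lambda>r. indicator S r *\<^sub>R f r) \<in> borel_measurable lborel"
    using f unfolding set_integrable_def by auto
  have 1: "integrable lborel (\<lambda>r. B * (indicator S r *\<^sub>R f r))"
    using f unfolding set_integrable_def by (rule integrable_mult_right)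
  have "integrable lborel (\<lambda>r. g r * (indicator S r *\<^sub>R f r))"
  proof (rule Bochner_Integration.integrable_bound[OF 1])
    show "AE r in lborel. norm (g r * (indicator S r *\<^sub>R f r)) \<le> norm (B * (indicator S r *\<^sub>R f r))"
      using B by (intro AE_I2) (force simp: indicator_def abs_mult intro!: mult_right_mono)
  qed measurable
  then show ?thesis unfolding set_integrable_def by (simp add: ac_simps)
qed

text \<open>Links the open half-line, on which the losses are integrated, with the closed one used
  by the fundamental theorem of calculus.\<close>

lemma AE_indicator_Ioi_eq_Ici:
  "AE r in lborel. (indicator {0<..} r :: 'b::zero_neq_one) = indicator {0::real..} r"
  using AE_lborel_singleton[of "0::real"] by eventually_elim (auto simp: indicator_def)

lemma antiderivative_tendsto_set_integral:
  fixes A :: "real \<Rightarrow> real"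
  assumes contA: "\<And>r. isCont A r" and int: "set_integrable lborel {0<..} A"
  obtains G where "\<And>r. (G has_real_derivative A r) (at r)" "G 0 = 0"
    "(G \<longlongrightarrow> (LINT r:{0<..}|lborel. A r)) at_top"
proof -
  have [measurable]: "A \<in> borel_measurable borel"
    using contA by (intro borel_measurable_continuous_onI continuous_at_imp_continuous_on) auto
  obtain G0 where G0: "\<And>r. (G0 has_vector_derivative A r) (at r)"
    using einterval_antiderivative[of "-\<infinity>" "\<infinity>" A] contA by auto
  define G where "G r = G0 r - G0 0" for r
  have G: "(G has_real_derivative A r) (at r)" for r
    using G0[of r] unfolding G_def
    by (auto intro!: derivative_eq_intros simp flip: has_real_derivative_iff_has_vector_derivative)
  have "AE r in lborel. indicator {0<..} r *\<^sub>R A r = indicator {0..} r *\<^sub>R A r"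
    using AE_indicator_Ioi_eq_Ici[where ?'b = real] by eventually_elim simp
  then have int': "set_integrable lborel {0..} A"
    and eq: "(LINT r:{0<..}|lborel. A r) = (LINT r:{0..}|lborel. A r)"
    using int unfolding set_integrable_def set_lebesgue_integral_def
    by (auto intro!: integral_cong_AE elim!: integrable_cong_AE_imp)
  have "((\<lambda>b. LINT r:{0..b}|lborel. A r) \<longlongrightarrow> (LINT r:{0..}|lborel. A r)) at_top"
    by (rule tendsto_set_lebesgue_integral_at_top) (use int' in auto)
  moreover have "\<forall>\<^sub>F b in at_top. (LINT r:{0..b}|lborel. A r) = G b"
    using eventually_ge_at_top[of 0]
  proof eventually_elim
    case (elim b)
    have "(G has_vector_derivative A x) (at x within {0..b})" for x
      using G[of x] has_vector_derivative_at_within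
      unfolding has_real_derivative_iff_has_vector_derivative by blast
    moreover have "continuous_on {0..b} A"
      by (intro continuous_at_imp_continuous_on ballI contA)
    ultimately have "(LBINT x. indicator {0..b} x *\<^sub>R A x) = G b - G 0"
      using elim by (intro integral_FTC_Icc)
    then show ?case by (simp add: set_lebesgue_integral_def G_def)
  qed
  ultimately have "(G \<longlongrightarrow> (LINT r:{0<..}|lborel. A r)) at_top"
    by (simp add: eq tendsto_cong)
  then show ?thesis using G that[of G] by (simp add: G_def)
qed

text \<open>\<open>B\<close> need not be continuous: it is the nonnegative derivative of \<open>G - H\<close>, with \<open>G\<close> an
  antiderivative of \<open>A\<close>, so the monotone form of the fundamental theorem of calculus applies.\<close>
lemma integral_split_derivative:
  fixes A B H :: "real \<Rightarrow> real"
  assumes contA: "\<And>r. isCont A r" and int: "set_integrable lborel {0<..} A"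
    and B[measurable]: "B \<in> borel_measurable borel" and nonneg: "\<And>r. 0 \<le> r \<Longrightarrow> 0 \<le> B r"
    and H: "\<And>r. 0 \<le> r \<Longrightarrow> (H has_real_derivative A r - B r) (at r)"
    and H0: "H 0 = 0" and lim: "(H \<longlongrightarrow> 0) at_top"
  shows "set_integrable lborel {0<..} B"
    and "(LINT r:{0<..}|lborel. B r) = (LINT r:{0<..}|lborel. A r)"
proof -
  obtain G where G: "\<And>r. (G has_real_derivative A r) (at r)" "G 0 = 0"
    and limG: "(G \<longlongrightarrow> (LINT r:{0<..}|lborel. A r)) at_top" (is "(_ \<longlongrightarrow> ?I) _")
    using antiderivative_tendsto_set_integral[OF contA int] by blast
  have D: "((\<lambda>r. G r - H r) has_real_derivative B r) (at r)" if "0 \<le> r" for r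
    using DERIV_diff[OF G(1)[of r] H[OF that]] by simp
  have L: "((\<lambda>r. G r - H r) \<longlongrightarrow> ?I) at_top"
    using tendsto_diff[OF limG lim] by simp
  have "(\<integral>\<^sup>+r. ennreal (B r) * indicator {0..} r \<partial>lborel) = ?I - (G 0 - H 0)"
    by (rule nn_integral_FTC_atLeast[OF B D nonneg L]) auto
  then have nn: "(\<integral>\<^sup>+r. ennreal (B r) * indicator {0..} r \<partial>lborel) = ?I"
    using G(2) H0 by simp
  \<comment> \<open>The coercion to \<open>ennreal\<close> sends negative reals to 0, so the sign of
    the limit must be known before the identity can be read in the reals.\<close>
  have "\<forall>\<^sub>F r in at_top. 0 \<le> G r - H r"
    using eventually_ge_at_top[of 0]
  proof eventually_elim
    case (elim r)
    have "G 0 - H 0 \<le> G r - H r"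
      using elim D nonneg by (intro DERIV_nonneg_imp_nondecreasing[OF elim]) blast
    then show ?case using G(2) H0 by simp
  qed
  then have I: "0 \<le> ?I"
    using tendsto_lowerbound[OF L] by simp
  have "(\<integral>\<^sup>+r. ennreal (indicator {0<..} r *\<^sub>R B r) \<partial>lborel) = (\<integral>\<^sup>+r. ennreal (B r) * indicator {0..} r \<partial>lborel)"
    using AE_indicator_Ioi_eq_Ici[where ?'b = real]
    by (intro nn_integral_cong_AE, eventually_elim) (auto simp: indicator_def)
  then have "has_bochner_integral lborel (\<lambda>r. indicator {0<..} r *\<^sub>R B r) ?I"
    using nn I nonneg by (intro has_bochner_integral_nn_integral) (auto simp: indicator_def)
  then show "set_integrable lborel {0<..} B"
    and "(LINT r:{0<..}|lborel. B r) = ?I"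
    unfolding set_integrable_def
    by (auto simp: has_bochner_integral_iff set_lebesgue_integral_def)
qed

subsection \<open>The risk difference on a ray\<close>

lemma cosh_real_mono_abs: "\<bar>x\<bar> \<le> \<bar>y::real\<bar> \<Longrightarrow> cosh x \<le> cosh y"
  using cosh_real_nonneg_le_iff[of "\<bar>x\<bar>" "\<bar>y\<bar>"] by simp

text \<open>The loss times the Gaussian density at the point r u, with the polar Jacobian included
  and the factors constant in r removed. Here a stands for u \<bullet> \<theta> and b for the
  squared norm of \<theta>.\<close>

definition ray_loss :: "nat \<Rightarrow> (real \<Rightarrow> real) \<Rightarrow> real \<Rightarrow> real \<Rightarrow> real \<Rightarrow> real" where
  "ray_loss n \<psi> a b r =
     ((r - \<psi> r / r)\<^sup>2 - 2 * a * (r - \<psi> r / r) + b) * r ^ (n - 1) * exp (- r\<^sup>2 / 2 + a * r)"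

locale shrinkage_profile =
  fixes \<phi> \<phi>' :: "real \<Rightarrow> real" and n :: nat
  assumes n3: "3 \<le> n"
    and deriv: "\<And>w. 0 \<le> w \<Longrightarrow> (\<phi> has_real_derivative \<phi>' w) (at w within {0..})"
    and below: "\<And>w. 0 < w \<Longrightarrow> \<phi> w < real n - 2"
    and deriv_nonneg: "\<And>w. 0 \<le> w \<Longrightarrow> 0 \<le> \<phi>' w"
    and nonneg: "\<And>w. 0 \<le> w \<Longrightarrow> 0 \<le> \<phi> w"
    and mono_ratio: "mono_on {0<..} (\<lambda>w. w * \<phi>' w / (real n - 2 - \<phi> w)\<^sup>2)"
begin

text \<open>This is the function \<delta>(r) of the overview.\<close>

definition gap :: "real \<Rightarrow> real" where
  "gap r = real n - 2 - \<phi> (r\<^sup>2)"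

text \<open>The extension by 0 keeps the function monotone on the whole line, because it is
  nonnegative. Monotonicity then yields Borel measurability without any continuity of
  \<open>\<phi>'\<close>.\<close>

definition ratio :: "real \<Rightarrow> real" where
  "ratio w = (if 0 < w then w * \<phi>' w / (real n - 2 - \<phi> w)\<^sup>2 else 0)"

text \<open>The unbiased estimate of the risk difference between the James--Stein estimator and
  \<open>phi_est \<phi>\<close> at radius \<open>r\<close>, multiplied by the polar Jacobian.\<close>
definition stein_diff :: "real \<Rightarrow> real" where
  "stein_diff r = r ^ (n - 3) * (gap r)\<^sup>2 * (4 * ratio (r\<^sup>2) - 1)"

text \<open>With every power written over the common factor \<open>r ^ (n - 3)\<close>, truncated
  subtraction disappears and the later identities become polynomial.\<close>

lemma power_n_shift:
  fixes r :: real
  shows "r ^ (n - 2) = r ^ (n - 3) * r" "r ^ (n - 1) = r ^ (n - 3) * r\<^sup>2"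
    "r ^ n = r ^ (n - 3) * r ^ 3" "r ^ (n + 1) = r ^ (n - 3) * r ^ 4"
proof -
  obtain m where "n = m + 3" using n3 by (metis add.commute le_Suc_ex)
  then show "r ^ (n - 2) = r ^ (n - 3) * r" "r ^ (n - 1) = r ^ (n - 3) * r\<^sup>2"
    "r ^ n = r ^ (n - 3) * r ^ 3" "r ^ (n + 1) = r ^ (n - 3) * r ^ 4"
    by (simp_all add: eval_nat_numeral)
qed

lemma ray_loss_expand:
  assumes "r \<noteq> 0"
  shows "ray_loss n \<psi> a b r = (r ^ 4 - 2 * \<psi> r * r\<^sup>2 + (\<psi> r)\<^sup>2 - 2 * a * r ^ 3 + 2 * a * \<psi> r * r + b * r\<^sup>2)
    * r ^ (n - 3) * exp (- r\<^sup>2 / 2 + a * r)"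
proof -
  have "((r - \<psi> r / r)\<^sup>2 - 2 * a * (r - \<psi> r / r) + b) * r\<^sup>2
      = r ^ 4 - 2 * \<psi> r * r\<^sup>2 + (\<psi> r)\<^sup>2 - 2 * a * r ^ 3 + 2 * a * \<psi> r * r + b * r\<^sup>2"
    using assms by (simp add: field_simps eval_nat_numeral)
  then show ?thesis
    unfolding ray_loss_def power_n_shift by (simp add: ac_simps)
qed

lemma ratio_nonneg: "0 \<le> ratio w"
  using deriv_nonneg[of w] by (simp add: ratio_def)

lemma mono_ratio_total: "mono ratio"
proof
  fix x y :: real assume "x \<le> y"
  show "ratio x \<le> ratio y"
  proof (cases "0 < x")
    case True
    then show ?thesis using mono_onD[OF mono_ratio, of x y] \<open>x \<le> y\<close> by (simp add: ratio_def)
  next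
    case False
    then show ?thesis using ratio_nonneg[of y] by (simp add: ratio_def)
  qed
qed

lemma borel_measurable_ratio [measurable]: "ratio \<in> borel_measurable borel"
  by (rule borel_measurable_mono[OF mono_ratio_total])

text \<open>Squaring maps the line into the closed half-line, so the one-sided derivative of
  \<open>\<phi>\<close> at 0 still gives a two-sided derivative here.\<close>

lemma DERIV_gap: "(gap has_real_derivative - (2 * r * \<phi>' (r\<^sup>2))) (at r)"
proof -
  have "(\<phi> has_real_derivative \<phi>' (r\<^sup>2)) (at (r\<^sup>2) within range (\<lambda>r. r\<^sup>2))"
    by (rule DERIV_subset[OF deriv]) auto
  moreover have "((\<lambda>r. r\<^sup>2) has_real_derivative 2 * r) (at r)"
    by (auto intro!: derivative_eq_intros)
  ultimately have "(\<phi> \<circ> (\<lambda>r. r\<^sup>2) has_real_derivative \<phi>' (r\<^sup>2) * (2 * r)) (at r)"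
    by (rule DERIV_image_chain)
  then show ?thesis
    unfolding gap_def by (auto intro!: derivative_eq_intros simp: o_def)
qed

lemma isCont_gap: "isCont gap r"
  using DERIV_gap DERIV_isCont by blast

lemma borel_measurable_gap [measurable]: "gap \<in> borel_measurable borel"
  using isCont_gap by (intro borel_measurable_continuous_onI continuous_at_imp_continuous_on) auto

lemma gap_pos: "0 < r \<Longrightarrow> 0 < gap r"
  using below[of "r\<^sup>2"] by (simp add: gap_def)

lemma gap_le: "gap r \<le> real n"
  using nonneg[of "r\<^sup>2"] by (simp add: gap_def)

text \<open>Expresses the term with \<open>\<phi>'\<close> through the measurable function
  \<open>ratio\<close>. At \<open>r = 0\<close> both sides vanish.\<close>

lemma gap_sq_ratio:
  assumes "0 \<le> r"
  shows "r ^ (n - 3) * (gap r)\<^sup>2 * ratio (r\<^sup>2) = r ^ (n - 1) * \<phi>' (r\<^sup>2)"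
proof (cases "r = 0")
  case True
  then show ?thesis using n3 by (simp add: ratio_def)
next
  case False
  then have "0 < gap r" using assms gap_pos by simp
  then show ?thesis
    using False power_n_shift(2)[of r] by (simp add: ratio_def gap_def field_simps)
qed

lemma set_integrable_gap_gauss:
  "set_integrable lborel {0<..} (\<lambda>r. gap r * (r ^ k * exp (- r\<^sup>2 / 2 + a * r)))"
  by (rule set_integrable_bounded_mult[OF set_integrable_power_gauss, where B = "real n"])
     (use gap_pos gap_le in \<open>auto simp: abs_of_pos\<close>)

lemma set_integrable_gap_sq_gauss:
  "set_integrable lborel {0<..} (\<lambda>r. (gap r)\<^sup>2 * (r ^ k * exp (- r\<^sup>2 / 2 + a * r)))"
  using set_integrable_bounded_mult[OF set_integrable_gap_gauss, of gap "real n" k a] gap_pos gap_le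
  by (auto simp: abs_of_pos power2_eq_square mult.assoc)

text \<open>Removes the boundary term at infinity in the integration by parts.\<close>

lemma tendsto_gap_gauss_0:
  "((\<lambda>r. r ^ k * gap r * exp (- r\<^sup>2 / 2 + a * r)) \<longlongrightarrow> 0) at_top"
proof (rule Lim_null_comparison)
  let ?m = "a + real k"
  show "((\<lambda>r. real n * exp (- r\<^sup>2 / 2 + ?m * r)) \<longlongrightarrow> 0) at_top"
    by real_asymp
  show "\<forall>\<^sub>F r in at_top. norm (r ^ k * gap r * exp (- r\<^sup>2 / 2 + a * r)) \<le> real n * exp (- r\<^sup>2 / 2 + ?m * r)"
    using eventually_gt_at_top[of 0]
  proof eventually_elim
    case (elim r)
    have "r \<le> exp r" using exp_ge_add_one_self[of r] by linarith
    then have "r ^ k \<le> exp (real k * r)"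
      using elim by (simp add: exp_of_nat_mult power_mono)
    then have "r ^ k * gap r * exp (- r\<^sup>2 / 2 + a * r) \<le> exp (real k * r) * real n * exp (- r\<^sup>2 / 2 + a * r)"
      using elim gap_pos[of r] gap_le[of r] by (intro mult_mono) auto
    also have "\<dots> = real n * (exp (real k * r) * exp (- r\<^sup>2 / 2 + a * r))" by simp
    also have "\<dots> = real n * exp (- r\<^sup>2 / 2 + ?m * r)"
      unfolding exp_add[symmetric] by (simp add: algebra_simps)
    finally show ?case using elim gap_pos[of r] by (simp add: abs_mult)
  qed
qed

text \<open>\<open>A a - B a\<close> is the derivative of
  \<open>r ^ (n - 2) * gap r * exp (- r\<^sup>2 / 2 + a * r)\<close>, which vanishes at 0 and at
  infinity. The continuous terms are collected in \<open>A\<close>; \<open>B\<close> holds the term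
  with \<open>\<phi>'\<close>, which is nonnegative, and its integrability comes out of the
  identity.\<close>

lemma stein_identity_on_ray:
  defines "A \<equiv> \<lambda>a r. ((real n - 2) * (gap r * r ^ (n - 3)) - gap r * r ^ (n - 2) * (r - a)) * exp (- r\<^sup>2 / 2 + a * r)"
    and "B \<equiv> \<lambda>a r. 2 * (r ^ (n - 3) * (gap r)\<^sup>2 * ratio (r\<^sup>2)) * exp (- r\<^sup>2 / 2 + a * r)"
  shows "set_integrable lborel {0<..} (A a)"
    and "set_integrable lborel {0<..} (B a)"
    and "(LINT r:{0<..}|lborel. B a r) = (LINT r:{0<..}|lborel. A a r)"
proof -
  let ?E = "\<lambda>r. exp (- r\<^sup>2 / 2 + a * r)"
  have "set_integrable lborel {0<..} (\<lambda>r. (real n - 2) * (gap r * (r ^ (n - 3) * ?E r))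
      - gap r * (r ^ Suc (n - 2) * ?E r) + a * (gap r * (r ^ (n - 2) * ?E r)))"
    by (intro set_integral_add set_integral_diff set_integrable_mult_right set_integrable_gap_gauss)
  also have "(\<lambda>r. (real n - 2) * (gap r * (r ^ (n - 3) * ?E r))
      - gap r * (r ^ Suc (n - 2) * ?E r) + a * (gap r * (r ^ (n - 2) * ?E r))) = A a"
    by (simp add: A_def fun_eq_iff algebra_simps)
  finally show intA: "set_integrable lborel {0<..} (A a)" .
  have contA: "isCont (A a) r" for r
    unfolding A_def by (intro continuous_intros isCont_gap) simp_all
  have B: "B a \<in> borel_measurable borel"
    unfolding B_def by measurable
  have Bnn: "0 \<le> B a r" if "0 \<le> r" for r
    using that ratio_nonneg by (simp add: B_def)
  let ?H = "\<lambda>r. r ^ (n - 2) * gap r * ?E r"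
  have H: "(?H has_real_derivative A a r - B a r) (at r)" if "0 \<le> r" for r
  proof -
    have E: "(?E has_real_derivative ?E r * (a - r)) (at r)"
      by (auto intro!: derivative_eq_intros)
    have P: "((\<lambda>r. r ^ (n - 2)) has_real_derivative (real n - 2) * r ^ (n - 3)) (at r)"
      using n3 DERIV_pow[of "n - 2" r] by (simp add: of_nat_diff)
    have pow: "r ^ (n - 2) * r = r ^ (n - 1)"
      unfolding power_n_shift by (simp add: power2_eq_square)
    have "(?H has_real_derivative ((real n - 2) * r ^ (n - 3) * gap r + - (2 * r * \<phi>' (r\<^sup>2)) * r ^ (n - 2)) * ?E r
        + ?E r * (a - r) * (r ^ (n - 2) * gap r)) (at r)"
      by (rule DERIV_mult[OF DERIV_mult[OF P DERIV_gap] E])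
    also have "((real n - 2) * r ^ (n - 3) * gap r + - (2 * r * \<phi>' (r\<^sup>2)) * r ^ (n - 2)) * ?E r
        + ?E r * (a - r) * (r ^ (n - 2) * gap r) = A a r - B a r"
      unfolding A_def B_def gap_sq_ratio[OF that] pow[symmetric] by (simp add: algebra_simps)
    finally show ?thesis .
  qed
  \<comment> \<open>The exponent \<open>n - 2\<close> is positive, so there is no boundary term at
    0.\<close>
  have H0: "?H 0 = 0" using n3 by simp
  show "set_integrable lborel {0<..} (B a)"
    by (rule integral_split_derivative(1)[OF contA intA B Bnn H H0 tendsto_gap_gauss_0])
  show "(LINT r:{0<..}|lborel. B a r) = (LINT r:{0<..}|lborel. A a r)"
    by (rule integral_split_derivative(2)[OF contA intA B Bnn H H0 tendsto_gap_gauss_0])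
qed

lemma set_integrable_stein_diff:
  "set_integrable lborel {0<..} (\<lambda>r. stein_diff r * exp (- r\<^sup>2 / 2 + a * r))"
proof -
  have "set_integrable lborel {0<..} (\<lambda>r. 2 * (2 * (r ^ (n - 3) * (gap r)\<^sup>2 * ratio (r\<^sup>2)) * exp (- r\<^sup>2 / 2 + a * r))
      - (gap r)\<^sup>2 * (r ^ (n - 3) * exp (- r\<^sup>2 / 2 + a * r)))"
    by (intro set_integral_diff set_integrable_mult_right stein_identity_on_ray(2) set_integrable_gap_sq_gauss)
  then show ?thesis
    by (rule set_integrable_cong[THEN iffD1, rotated -1]) (auto simp: stein_diff_def algebra_simps)
qed

lemma set_integrable_ray_loss:
  assumes [measurable]: "\<psi> \<in> borel_measurable borel" and B: "\<And>r. 0 < r \<Longrightarrow> \<bar>\<psi> r\<bar> \<le> B"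
  shows "set_integrable lborel {0<..} (ray_loss n \<psi> a b)"
proof -
  let ?E = "\<lambda>r. exp (- r\<^sup>2 / 2 + a * r)"
  have 1: "set_integrable lborel {0<..} (\<lambda>r. \<psi> r * (r ^ k * ?E r))" for k
    by (rule set_integrable_bounded_mult[OF set_integrable_power_gauss, where B = B]) (use B in auto)
  have 2: "set_integrable lborel {0<..} (\<lambda>r. \<psi> r * (\<psi> r * (r ^ k * ?E r)))" for k
    by (rule set_integrable_bounded_mult[OF 1, where B = B]) (use B in auto)
  have "set_integrable lborel {0<..} (\<lambda>r. r ^ (n + 1) * ?E r - 2 * (\<psi> r * (r ^ (n - 1) * ?E r))
     + \<psi> r * (\<psi> r * (r ^ (n - 3) * ?E r))
     - 2 * a * (r ^ n * ?E r) + 2 * a * (\<psi> r * (r ^ (n - 2) * ?E r)) + b * (r ^ (n - 1) * ?E r))"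
    by (intro set_integral_add set_integral_diff set_integrable_mult_right set_integrable_power_gauss 1 2)
  then show ?thesis
  proof (rule set_integrable_cong[THEN iffD1, rotated -1])
    fix r :: real assume r: "r \<in> {0<..}"
    show "r ^ (n + 1) * ?E r - 2 * (\<psi> r * (r ^ (n - 1) * ?E r))
     + \<psi> r * (\<psi> r * (r ^ (n - 3) * ?E r))
     - 2 * a * (r ^ n * ?E r) + 2 * a * (\<psi> r * (r ^ (n - 2) * ?E r)) + b * (r ^ (n - 1) * ?E r) = ray_loss n \<psi> a b r"
      using r unfolding power_n_shift ray_loss_expand[of r, OF r[simplified, THEN less_imp_neq, symmetric]]
      by algebra
  qed auto
qed

text \<open>Pointwise the difference is 2A - C, where C comes from the square of \<open>gap\<close>.
  Stein's identity replaces A by B under the integral, and 2B - C is the new integrand. The constant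
  \<open>b\<close> cancels.\<close>

lemma ray_loss_diff:
  "(LINT r:{0<..}|lborel. ray_loss n (\<lambda>_. real n - 2) a b r - ray_loss n (\<lambda>r. \<phi> (r\<^sup>2)) a b r)
    = (LINT r:{0<..}|lborel. stein_diff r * exp (- r\<^sup>2 / 2 + a * r))"
proof -
  let ?E = "\<lambda>r. exp (- r\<^sup>2 / 2 + a * r)"
  let ?A = "\<lambda>r. ((real n - 2) * (gap r * r ^ (n - 3)) - gap r * r ^ (n - 2) * (r - a)) * ?E r"
  let ?B = "\<lambda>r. 2 * (r ^ (n - 3) * (gap r)\<^sup>2 * ratio (r\<^sup>2)) * ?E r"
  let ?C = "\<lambda>r. (gap r)\<^sup>2 * (r ^ (n - 3) * ?E r)"
  have "ray_loss n (\<lambda>_. real n - 2) a b r - ray_loss n (\<lambda>r. \<phi> (r\<^sup>2)) a b r = 2 * ?A r - ?C r" if "0 < r" for r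
  proof -
    have phi: "\<phi> (r\<^sup>2) = real n - 2 - gap r" by (simp add: gap_def)
    show ?thesis
      unfolding ray_loss_expand[OF that[THEN less_imp_neq, symmetric]] phi power_n_shift
      by algebra
  qed
  then have "(LINT r:{0<..}|lborel. ray_loss n (\<lambda>_. real n - 2) a b r - ray_loss n (\<lambda>r. \<phi> (r\<^sup>2)) a b r)
      = (LINT r:{0<..}|lborel. 2 * ?A r - ?C r)"
    by (intro set_lebesgue_integral_cong) auto
  also have "\<dots> = 2 * (LINT r:{0<..}|lborel. ?A r) - (LINT r:{0<..}|lborel. ?C r)"
    by (subst set_integral_diff(2)) (intro set_integrable_mult_right stein_identity_on_ray(1) set_integrable_gap_sq_gauss | simp only: set_integral_mult_right)+
  also have "\<dots> = 2 * (LINT r:{0<..}|lborel. ?B r) - (LINT r:{0<..}|lborel. ?C r)"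
    by (simp only: stein_identity_on_ray(3))
  also have "\<dots> = (LINT r:{0<..}|lborel. 2 * ?B r - ?C r)"
    by (subst set_integral_diff(2)) (intro set_integrable_mult_right stein_identity_on_ray(2) set_integrable_gap_sq_gauss | simp only: set_integral_mult_right)+
  also have "\<dots> = (LINT r:{0<..}|lborel. stein_diff r * ?E r)"
    by (intro set_lebesgue_integral_cong) (auto simp: stein_diff_def algebra_simps)
  finally show ?thesis .
qed

section \<open>The sign change and the cosh-weighted integral\<close>

lemma stein_diff_sign_mono:
  assumes "0 < r" "r \<le> s" "0 \<le> stein_diff r"
  shows "0 \<le> stein_diff s"
proof -
  \<comment> \<open>The prefactor is positive, so the sign is that of
    \<open>4 * ratio (r\<^sup>2) - 1\<close>, which is monotone in r > 0.\<close>
  have "0 < r ^ (n - 3) * (gap r)\<^sup>2" using assms(1) gap_pos[of r] by simp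
  then have "0 \<le> 4 * ratio (r\<^sup>2) - 1"
    using assms(3) unfolding stein_diff_def by (simp add: zero_le_mult_iff)
  also have "ratio (r\<^sup>2) \<le> ratio (s\<^sup>2)"
    using assms by (intro monoD[OF mono_ratio_total] power_mono) auto
  finally show ?thesis using assms by (simp add: stein_diff_def)
qed

lemma stein_diff_cosh_nonneg:
  assumes "0 \<le> (LINT r:{0<..}|lborel. stein_diff r * exp (- r\<^sup>2 / 2))"
  shows "0 \<le> (LINT r:{0<..}|lborel. stein_diff r * exp (- r\<^sup>2 / 2) * cosh (a * r))"
proof -
  let ?D = "\<lambda>r. stein_diff r * exp (- r\<^sup>2 / 2)"
  have int0: "set_integrable lborel {0<..} ?D"
    using set_integrable_stein_diff[of 0] by simp
  have "set_integrable lborel {0<..} (\<lambda>r. (1/2) * (stein_diff r * exp (- r\<^sup>2 / 2 + a * r) + stein_diff r * exp (- r\<^sup>2 / 2 + (- a) * r)))"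
    by (intro set_integrable_mult_right set_integral_add set_integrable_stein_diff)
  then have int: "set_integrable lborel {0<..} (\<lambda>r. ?D r * cosh (a * r))"
  proof (rule set_integrable_cong[THEN iffD1, rotated -1])
    fix r :: real
    show "(1/2) * (stein_diff r * exp (- r\<^sup>2 / 2 + a * r) + stein_diff r * exp (- r\<^sup>2 / 2 + (- a) * r)) = ?D r * cosh (a * r)"
      unfolding exp_add cosh_field_def by (simp add: field_simps)
  qed auto
  show ?thesis
  proof (cases "\<exists>r>0. 0 \<le> stein_diff r")
    case True
    define S where "S = {r. 0 < r \<and> 0 \<le> stein_diff r}"
    \<comment> \<open>The crossing point: negative values lie to the left of \<open>r0\<close>,
      nonnegative ones to the right.\<close>
    define r0 where "r0 = Inf S"
    have S: "S \<noteq> {}" "bdd_below S" using True by (auto simp: S_def intro!: bdd_belowI[of _ 0])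
    have r0: "0 \<le> r0" unfolding r0_def using S by (intro cInf_greatest) (auto simp: S_def)
    \<comment> \<open>The difference of the two sides is \<open>?D r\<close> times cosh (a r) - cosh
      (a r0), two factors that never have opposite signs.\<close>
    have pw: "cosh (a * r0) * ?D r \<le> ?D r * cosh (a * r)" if "0 < r" for r
    proof (cases "0 \<le> stein_diff r")
      case True
      then have "r0 \<le> r" unfolding r0_def using S that by (intro cInf_lower) (auto simp: S_def)
      then have "cosh (a * r0) \<le> cosh (a * r)"
        using r0 that by (intro cosh_real_mono_abs) (simp add: abs_mult mult_left_mono)
      then show ?thesis using True by (subst mult.commute, intro mult_left_mono) auto
    next
      case False
      have "r \<le> r0" unfolding r0_def using S(1)
      proof (rule cInf_greatest)
        fix s assume "s \<in> S"
        then show "r \<le> s" using False stein_diff_sign_mono[of s r] by (force simp: S_def)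
      qed
      then have "cosh (a * r) \<le> cosh (a * r0)"
        using r0 that by (intro cosh_real_mono_abs) (simp add: abs_mult mult_left_mono)
      moreover have "?D r \<le> 0" using False by (simp add: mult_nonpos_nonneg)
      ultimately show ?thesis by (subst mult.commute, intro mult_left_mono_neg) auto
    qed
    have "0 \<le> cosh (a * r0) * (LINT r:{0<..}|lborel. ?D r)"
      using assms by simp
    also have "\<dots> = (LINT r:{0<..}|lborel. cosh (a * r0) * ?D r)" by simp
    also have "\<dots> \<le> (LINT r:{0<..}|lborel. ?D r * cosh (a * r))"
      using pw by (intro set_integral_mono set_integrable_mult_right int0 int) auto
    finally show ?thesis .
  next
    case False
    \<comment> \<open>Now \<open>stein_diff\<close> is negative on the whole half-line, so the
      assumption forces its integrand to vanish almost everywhere, and the cosh-weighted one with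
      it.\<close>
    then have neg: "0 \<le> - (indicator {0<..} r *\<^sub>R ?D r)" for r
      by (auto simp: indicator_def mult_nonpos_nonneg not_le less_imp_le)
    have "integrable lborel (\<lambda>r. - (indicator {0<..} r *\<^sub>R ?D r))"
      using int0 unfolding set_integrable_def by simp
    moreover have "integral\<^sup>L lborel (\<lambda>r. - (indicator {0<..} r *\<^sub>R ?D r)) = 0"
    proof (rule antisym)
      show "integral\<^sup>L lborel (\<lambda>r. - (indicator {0<..} r *\<^sub>R ?D r)) \<le> 0"
        using assms unfolding set_lebesgue_integral_def by simp
      show "0 \<le> integral\<^sup>L lborel (\<lambda>r. - (indicator {0<..} r *\<^sub>R ?D r))"
        by (rule integral_nonneg_AE) (use neg in auto)
    qed
    ultimately have "AE r in lborel. - (indicator {0<..} r *\<^sub>R ?D r) = 0"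
      using neg by (subst (asm) integral_nonneg_eq_0_iff_AE) auto
    then have "(LINT r:{0<..}|lborel. ?D r * cosh (a * r)) = 0"
      unfolding set_lebesgue_integral_def
      by (intro integral_eq_zero_AE) (auto simp: indicator_def elim!: eventually_mono)
    then show ?thesis by simp
  qed
qed

end

subsection \<open>Risk of radial shrinkage estimators\<close>

text \<open>Common form of both estimators: \<psi>(r) is \<phi>(r^2) for \<open>phi_est\<close> and
  the constant p - 2 for \<open>js_est\<close>.\<close>

definition radial_est :: "(real \<Rightarrow> real) \<Rightarrow> 'a::real_normed_vector \<Rightarrow> 'a" where
  "radial_est \<psi> x = (1 - \<psi> (norm x) / (norm x)\<^sup>2) *\<^sub>R x"

lemma borel_measurable_radial_est [measurable]:
  assumes [measurable]: "\<psi> \<in> borel_measurable borel"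
  shows "radial_est \<psi> \<in> borel_measurable (borel :: 'a::euclidean_space measure)"
  unfolding radial_est_def by measurable

lemma borel_measurable_ray_loss [measurable (raw)]:
  assumes [measurable]: "\<psi> \<in> borel_measurable borel" "f \<in> borel_measurable M" "g \<in> borel_measurable M" "h \<in> borel_measurable M"
  shows "(\<lambda>x. ray_loss n \<psi> (f x) (g x) (h x)) \<in> borel_measurable M"
  unfolding ray_loss_def by measurable

lemma borel_measurable_normal_density_vec [measurable]:
  "Defs.normal_density (\<theta> :: real^'n) \<in> borel_measurable borel"
  unfolding Defs.normal_density_def by measurable

text \<open>Complete the square in q = r - \<psi>(r)/r. On actual rays the condition on
  \<open>a\<close> and \<open>b\<close> is the Cauchy-Schwarz inequality.\<close>

lemma ray_loss_nonneg:
  assumes "a\<^sup>2 \<le> b" "0 < r"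
  shows "0 \<le> ray_loss n \<psi> a b r"
proof -
  let ?q = "r - \<psi> r / r"
  have "0 \<le> (?q - a)\<^sup>2 + (b - a\<^sup>2)" using assms(1) by simp
  also have "\<dots> = ?q\<^sup>2 - 2 * a * ?q + b" by (simp add: power2_diff)
  finally show ?thesis using assms(2) by (simp add: ray_loss_def)
qed

text \<open>The part of the normal density at s u that depends on neither s nor u.\<close>

definition ray_const :: "real^'n \<Rightarrow> real" where
  "ray_const \<theta> = (2 * pi) powr (- real CARD('n) / 2) * exp (- (norm \<theta>)\<^sup>2 / 2)"

lemma ray_const_pos: "0 < ray_const \<theta>"
  by (simp add: ray_const_def)

lemma loss_on_ray:
  fixes u \<theta> :: "real^'n"
  assumes u: "norm u = 1" and s: "0 < s"
  shows "s ^ (CARD('n) - 1) * ((norm (radial_est \<psi> (s *\<^sub>R u) - \<theta>))\<^sup>2 * Defs.normal_density \<theta> (s *\<^sub>R u))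
    = ray_const \<theta> * ray_loss CARD('n) \<psi> (u \<bullet> \<theta>) ((norm \<theta>)\<^sup>2) s"
proof -
  have expand: "(norm (q *\<^sub>R u - \<theta>))\<^sup>2 = q\<^sup>2 - 2 * (u \<bullet> \<theta>) * q + (norm \<theta>)\<^sup>2" for q
  proof -
    have "u \<bullet> u = 1" using u by (simp add: norm_eq_1)
    then show ?thesis
      unfolding power2_norm_eq_inner
      by (simp add: inner_diff inner_commute[of \<theta> u] power2_eq_square algebra_simps)
  qed
  have "radial_est \<psi> (s *\<^sub>R u) = (s - \<psi> s / s) *\<^sub>R u"
    using u s by (simp add: radial_est_def power2_eq_square left_diff_distrib)
  moreover have "exp (- (norm (s *\<^sub>R u - \<theta>))\<^sup>2 / 2)
      = exp (- (norm \<theta>)\<^sup>2 / 2) * exp (- s\<^sup>2 / 2 + (u \<bullet> \<theta>) * s)"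
    unfolding expand exp_add[symmetric] by (simp add: field_simps)
  ultimately show ?thesis
    by (simp only: Defs.normal_density_def ray_const_def ray_loss_def expand ac_simps)
qed

definition ray_risk :: "nat \<Rightarrow> (real \<Rightarrow> real) \<Rightarrow> real \<Rightarrow> real \<Rightarrow> ennreal" where
  "ray_risk n \<psi> a b = (\<integral>\<^sup>+s. ennreal (ray_loss n \<psi> a b s) * indicator {0<..} s \<partial>lborel)"

lemma borel_measurable_ray_risk [measurable (raw)]:
  assumes [measurable]: "\<psi> \<in> borel_measurable borel" "f \<in> borel_measurable M"
  shows "(\<lambda>x. ray_risk n \<psi> (f x) b) \<in> borel_measurable M"
  unfolding ray_risk_def by measurable

lemma risk_radial_est:
  fixes \<theta> :: "real^'n"
  assumes [measurable]: "\<psi> \<in> borel_measurable borel"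
  shows "risk \<theta> (radial_est \<psi>) =
    (\<integral>\<^sup>+x. ennreal (ray_const \<theta> * direction_weight (x :: real^'n)) * ray_risk CARD('n) \<psi> (sgn x \<bullet> \<theta>) ((norm \<theta>)\<^sup>2) \<partial>lborel)"
proof -
  let ?f = "\<lambda>x. ennreal ((norm (radial_est \<psi> x - \<theta>))\<^sup>2 * Defs.normal_density \<theta> x)"
  have "risk \<theta> (radial_est \<psi>) = (\<integral>\<^sup>+x. ?f x \<partial>lborel)"
    by (simp add: risk_def)
  also have "\<dots> = (\<integral>\<^sup>+x. ennreal (direction_weight (x :: real^'n)) *
      (\<integral>\<^sup>+s. ennreal (s ^ (DIM(real^'n) - 1)) * ?f (s *\<^sub>R sgn x) * indicator {0<..} s \<partial>lborel) \<partial>lborel)"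
    by (rule nn_integral_polar) measurable
  also have "\<dots> = (\<integral>\<^sup>+x. ennreal (ray_const \<theta> * direction_weight (x :: real^'n)) * ray_risk CARD('n) \<psi> (sgn x \<bullet> \<theta>) ((norm \<theta>)\<^sup>2) \<partial>lborel)"
  proof (rule nn_integral_cong)
    fix x :: "real^'n"
    show "ennreal (direction_weight x) * (\<integral>\<^sup>+s. ennreal (s ^ (DIM(real^'n) - 1)) * ?f (s *\<^sub>R sgn x) * indicator {0<..} s \<partial>lborel)
      = ennreal (ray_const \<theta> * direction_weight x) * ray_risk CARD('n) \<psi> (sgn x \<bullet> \<theta>) ((norm \<theta>)\<^sup>2)"
    proof (cases "x = 0")
      \<comment> \<open>At the origin \<open>sgn x\<close> is not a unit vector, but there the
        weight is 0.\<close>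
      case False
      then have u: "norm (sgn x) = 1" by (simp add: norm_sgn)
      have "(\<integral>\<^sup>+s. ennreal (s ^ (DIM(real^'n) - 1)) * ?f (s *\<^sub>R sgn x) * indicator {0<..} s \<partial>lborel)
        = (\<integral>\<^sup>+s. ennreal (ray_const \<theta>) * (ennreal (ray_loss CARD('n) \<psi> (sgn x \<bullet> \<theta>) ((norm \<theta>)\<^sup>2) s) * indicator {0<..} s) \<partial>lborel)"
      proof (rule nn_integral_cong)
        fix s :: real
        show "ennreal (s ^ (DIM(real^'n) - 1)) * ?f (s *\<^sub>R sgn x) * indicator {0<..} s
          = ennreal (ray_const \<theta>) * (ennreal (ray_loss CARD('n) \<psi> (sgn x \<bullet> \<theta>) ((norm \<theta>)\<^sup>2) s) * indicator {0<..} s)"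
        proof (cases "0 < s")
          case True
          have "ennreal (s ^ (CARD('n) - 1)) * ?f (s *\<^sub>R sgn x)
              = ennreal (ray_const \<theta>) * ennreal (ray_loss CARD('n) \<psi> (sgn x \<bullet> \<theta>) ((norm \<theta>)\<^sup>2) s)"
            using True loss_on_ray[OF u True, of \<psi> \<theta>] ray_const_pos[of \<theta>]
            by (simp add: ennreal_mult'[symmetric])
          then show ?thesis by (simp add: mult.assoc[symmetric])
        qed simp
      qed
      then show ?thesis
        using ray_const_pos[of \<theta>] direction_weight_nonneg[of x]
        by (simp add: nn_integral_cmult ray_risk_def ennreal_mult ac_simps)
    qed simp
  qed
  finally show ?thesis .
qed

text \<open>The estimator is odd and Lebesgue measure is invariant under x \<mapsto> -x. This
  realizes the pairing of opposite rays: negating \<theta> turns \<open>a\<close> into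
  \<open>- a\<close> for every direction.\<close>

lemma risk_radial_est_minus:
  fixes \<theta> :: "real^'n"
  assumes [measurable]: "\<psi> \<in> borel_measurable borel"
  shows "risk (- \<theta>) (radial_est \<psi>) = risk \<theta> (radial_est \<psi>)"
proof -
  let ?f = "\<lambda>x. ennreal ((norm (radial_est \<psi> x - \<theta>))\<^sup>2 * Defs.normal_density \<theta> x)"
  have odd: "radial_est \<psi> (- x) = - radial_est \<psi> x" for x :: "real^'n"
    by (simp add: radial_est_def)
  have sym: "norm (radial_est \<psi> x + \<theta>) = norm (- radial_est \<psi> x - \<theta>)" "norm (x + \<theta>) = norm (- x - \<theta>)" for x
    using norm_minus_cancel[of "radial_est \<psi> x + \<theta>"] norm_minus_cancel[of "x + \<theta>"]
    by simp_all
  have "risk \<theta> (radial_est \<psi>) = (\<integral>\<^sup>+x. ?f x \<partial>lborel)" by (simp add: risk_def)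
  also have "\<dots> = (\<integral>\<^sup>+x. ?f (- x) \<partial>lborel)"
    by (subst nn_integral_lborel_scaleR[of _ "-1"]) auto
  also have "\<dots> = risk (- \<theta>) (radial_est \<psi>)"
    by (simp add: risk_def Defs.normal_density_def sym odd)
  finally show ?thesis ..
qed

section \<open>Comparison on a pair of opposite rays\<close>

context shrinkage_profile begin

lemma ray_risk_eq_integral:
  assumes [measurable]: "\<psi> \<in> borel_measurable borel" and B: "\<And>r. 0 < r \<Longrightarrow> \<bar>\<psi> r\<bar> \<le> B" and ab: "a\<^sup>2 \<le> b"
  shows "ray_risk n \<psi> a b = ennreal (LINT s:{0<..}|lborel. ray_loss n \<psi> a b s)"
    and "0 \<le> (LINT s:{0<..}|lborel. ray_loss n \<psi> a b s)"
proof -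
  have nn: "0 \<le> indicator {0<..} s *\<^sub>R ray_loss n \<psi> a b s" for s
    using ray_loss_nonneg[OF ab] by (simp add: indicator_def)
  have "ray_risk n \<psi> a b = (\<integral>\<^sup>+s. ennreal (indicator {0<..} s *\<^sub>R ray_loss n \<psi> a b s) \<partial>lborel)"
    unfolding ray_risk_def by (intro nn_integral_cong) (auto simp: indicator_def)
  also have "\<dots> = ennreal (LINT s:{0<..}|lborel. ray_loss n \<psi> a b s)"
    unfolding set_lebesgue_integral_def
    using set_integrable_ray_loss[OF assms(1) B, of a b] nn unfolding set_integrable_def
    by (intro nn_integral_eq_integral) auto
  finally show "ray_risk n \<psi> a b = ennreal (LINT s:{0<..}|lborel. ray_loss n \<psi> a b s)" .
  show "0 \<le> (LINT s:{0<..}|lborel. ray_loss n \<psi> a b s)"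
    unfolding set_lebesgue_integral_def by (rule integral_nonneg_AE) (use nn in auto)
qed

lemma borel_measurable_profile [measurable]: "(\<lambda>r. \<phi> (r\<^sup>2)) \<in> borel_measurable borel"
proof -
  have "(\<lambda>r. \<phi> (r\<^sup>2)) = (\<lambda>r. real n - 2 - gap r)" by (simp add: gap_def)
  also have "\<dots> \<in> borel_measurable borel" by measurable
  finally show ?thesis .
qed

lemma profile_bounded: "0 < r \<Longrightarrow> \<bar>\<phi> (r\<^sup>2)\<bar> \<le> real n"
  using below[of "r\<^sup>2"] nonneg[of "r\<^sup>2"] by simp

text \<open>The gain at \<open>a\<close> plus the gain at \<open>- a\<close> is twice the
  cosh-weighted integral of \<open>stein_diff\<close>, whose sign is controlled by the comparison at
  the origin.\<close>

lemma ray_risk_symmetrized_le: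
  assumes origin: "ray_risk n (\<lambda>r. \<phi> (r\<^sup>2)) 0 0 \<le> ray_risk n (\<lambda>_. real n - 2) 0 0" and ab: "a\<^sup>2 \<le> b"
  shows "ray_risk n (\<lambda>r. \<phi> (r\<^sup>2)) a b + ray_risk n (\<lambda>r. \<phi> (r\<^sup>2)) (- a) b
    \<le> ray_risk n (\<lambda>_. real n - 2) a b + ray_risk n (\<lambda>_. real n - 2) (- a) b"
proof -
  let ?p = "\<lambda>a b. LINT s:{0<..}|lborel. ray_loss n (\<lambda>r. \<phi> (r\<^sup>2)) a b s"
  let ?j = "\<lambda>a b. LINT s:{0<..}|lborel. ray_loss n (\<lambda>_. real n - 2) a b s"
  let ?D = "\<lambda>a. LINT r:{0<..}|lborel. stein_diff r * exp (- r\<^sup>2 / 2 + a * r)"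
  note p = ray_risk_eq_integral[OF borel_measurable_profile profile_bounded]
  note j = ray_risk_eq_integral[of "\<lambda>_. real n - 2" "\<bar>real n - 2\<bar>", OF borel_measurable_const order_refl]
  have diff: "?j a b - ?p a b = ?D a" for a b
    by (subst ray_loss_diff[symmetric, where b = b], subst set_integral_diff(2))
       (auto intro!: set_integrable_ray_loss profile_bounded)
  have "ennreal (?p 0 0) \<le> ennreal (?j 0 0)"
    using origin p(1)[of 0 0] j(1)[of 0 0] by simp
  then have "?p 0 0 \<le> ?j 0 0"
    using j(2)[of 0 0] by (simp add: ennreal_le_iff)
  then have "0 \<le> (LINT r:{0<..}|lborel. stein_diff r * exp (- r\<^sup>2 / 2))"
    using diff[of 0 0] by simp
  from stein_diff_cosh_nonneg[OF this, of a]
  have "0 \<le> 2 * (LINT r:{0<..}|lborel. stein_diff r * exp (- r\<^sup>2 / 2) * cosh (a * r))" by simp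
  also have "\<dots> = (LINT r:{0<..}|lborel. 2 * (stein_diff r * exp (- r\<^sup>2 / 2) * cosh (a * r)))"
    by simp
  also have "\<dots> = (LINT r:{0<..}|lborel. stein_diff r * exp (- r\<^sup>2 / 2 + a * r) + stein_diff r * exp (- r\<^sup>2 / 2 + (- a) * r))"
  proof (rule set_lebesgue_integral_cong)
    show "\<forall>r. r \<in> {0<..} \<longrightarrow> 2 * (stein_diff r * exp (- r\<^sup>2 / 2) * cosh (a * r))
      = stein_diff r * exp (- r\<^sup>2 / 2 + a * r) + stein_diff r * exp (- r\<^sup>2 / 2 + (- a) * r)"
      unfolding exp_add cosh_field_def by (simp add: field_simps)
  qed simp
  also have "\<dots> = ?D a + ?D (- a)"
    by (intro set_integral_add set_integrable_stein_diff)
  finally have "?p a b + ?p (- a) b \<le> ?j a b + ?j (- a) b"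
    using diff[of a b] diff[of "- a" b] by simp
  then show ?thesis
    \<comment> \<open>Nonnegativity of all four integrals lets the real inequality be lifted to sums
      in \<open>ennreal\<close>.\<close>
    using ab p(1)[of a b] p(1)[of "- a" b] j(1)[of a b] j(1)[of "- a" b]
      p(2)[of a b] p(2)[of "- a" b] j(2)[of a b] j(2)[of "- a" b]
    by (simp flip: ennreal_plus)
qed

end

section \<open>Averaging over directions\<close>

theorem theorem1:
  fixes \<phi> \<phi>' :: "real \<Rightarrow> real"
  assumes p3: "CARD('n::finite) \<ge> 3"
    and deriv: "\<And>w. w \<ge> 0 \<Longrightarrow> (\<phi> has_real_derivative \<phi>' w) (at w within {0..})"
    and below: "\<And>w. w > 0 \<Longrightarrow> \<phi> w < real CARD('n) - 2"
    and A1: "\<And>w. w \<ge> 0 \<Longrightarrow> \<phi>' w \<ge> 0"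
    and A2: "\<And>w. w \<ge> 0 \<Longrightarrow> \<phi> w \<ge> 0"
    and A4: "(\<phi> \<longlongrightarrow> real CARD('n) - 2) at_top"
    and A6: "mono_on {0<..} (\<lambda>w. w * \<phi>' w / (real CARD('n) - 2 - \<phi> w)\<^sup>2)"
    and A7: "risk (0::real^'n) js_est \<ge> risk (0::real^'n) (phi_est \<phi>)"
  shows "\<forall>\<theta>::real^'n. risk \<theta> (phi_est \<phi>) \<le> risk \<theta> js_est"
proof
  fix \<theta> :: "real^'n"
  let ?n = "CARD('n)"
  interpret shrinkage_profile \<phi> \<phi>' ?n
    using p3 deriv below A1 A2 A6 by unfold_locales auto
  let ?p = "\<lambda>r. \<phi> (r\<^sup>2)" and ?j = "\<lambda>r::real. real ?n - 2"
  have phi: "phi_est \<phi> = (radial_est ?p :: real^'n \<Rightarrow> _)"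
    by (simp add: fun_eq_iff phi_est_def radial_est_def)
  have js: "js_est = (radial_est ?j :: real^'n \<Rightarrow> _)"
    by (simp add: fun_eq_iff js_est_def radial_est_def)
  \<comment> \<open>At \<theta> = 0 the ray risk does not depend on the direction, so the whole risk
    is \<open>?K\<close> times it. Cancelling \<open>?K\<close>, positive and finite, reduces the
    dominance at the origin to a single ray.\<close>
  let ?K = "\<integral>\<^sup>+x. ennreal (ray_const (0::real^'n) * direction_weight (x :: real^'n)) \<partial>lborel"
  have K: "?K = ennreal (ray_const (0::real^'n)) * (\<integral>\<^sup>+x. ennreal (direction_weight (x :: real^'n)) \<partial>lborel)"
    using ray_const_pos[of "0::real^'n"]
    by (simp add: ennreal_mult direction_weight_nonneg nn_integral_cmult)
  have K_fin: "?K \<noteq> 0" "?K \<noteq> top"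
    using direction_weight_integral_pos_finite[where ?'a = "real^'n"] ray_const_pos[of "0::real^'n"]
    unfolding K by (auto simp: ennreal_mult_eq_top_iff)
  have at0: "risk (0::real^'n) (radial_est \<psi>) = ?K * ray_risk ?n \<psi> 0 0"
    if [measurable]: "\<psi> \<in> borel_measurable borel" for \<psi>
    by (simp add: risk_radial_est nn_integral_multc)
  have origin: "ray_risk ?n ?p 0 0 \<le> ray_risk ?n ?j 0 0"
    using A7 K_fin unfolding phi js by (simp add: at0 ennreal_mult_le_mult_iff)
  have twice: "2 * risk \<theta> (radial_est \<psi>) = (\<integral>\<^sup>+x. ennreal (ray_const \<theta> * direction_weight (x :: real^'n)) *
      (ray_risk ?n \<psi> (sgn x \<bullet> \<theta>) ((norm \<theta>)\<^sup>2) + ray_risk ?n \<psi> (- (sgn x \<bullet> \<theta>)) ((norm \<theta>)\<^sup>2)) \<partial>lborel)"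
    if [measurable]: "\<psi> \<in> borel_measurable borel" for \<psi>
  proof -
    have c: "ray_const (- \<theta>) = ray_const \<theta>" by (simp add: ray_const_def)
    have "2 * risk \<theta> (radial_est \<psi>) = risk \<theta> (radial_est \<psi>) + risk (- \<theta>) (radial_est \<psi>)"
      by (simp add: risk_radial_est_minus mult_2)
    also have "\<dots> = (\<integral>\<^sup>+x. ennreal (ray_const \<theta> * direction_weight (x :: real^'n)) *
      (ray_risk ?n \<psi> (sgn x \<bullet> \<theta>) ((norm \<theta>)\<^sup>2) + ray_risk ?n \<psi> (- (sgn x \<bullet> \<theta>)) ((norm \<theta>)\<^sup>2)) \<partial>lborel)"
      by (simp add: risk_radial_est c distrib_left nn_integral_add)
    finally show ?thesis .
  qed
  \<comment> \<open>The symmetrized integrands are compared direction by direction; the doubling is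
    cancelled at the end.\<close>
  have "2 * risk \<theta> (radial_est ?p) \<le> 2 * risk \<theta> (radial_est ?j)"
    unfolding twice[OF borel_measurable_profile] twice[OF borel_measurable_const]
  proof (intro nn_integral_mono mult_left_mono ray_risk_symmetrized_le origin)
    fix x :: "real^'n"
    have "\<bar>sgn x \<bullet> \<theta>\<bar> \<le> norm (sgn x) * norm \<theta>" by (rule Cauchy_Schwarz_ineq2)
    \<comment> \<open>Holds at \<open>x = 0\<close> too, where \<open>sgn x\<close> is 0.\<close>
    also have "\<dots> \<le> norm \<theta>" by (simp add: norm_sgn)
    finally show "(sgn x \<bullet> \<theta>)\<^sup>2 \<le> (norm \<theta>)\<^sup>2"
      by (simp add: abs_le_square_iff[symmetric])
  qed simp
  then show "risk \<theta> (phi_est \<phi>) \<le> risk \<theta> js_est"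
    unfolding phi js by (simp add: ennreal_mult_le_mult_iff)
qed

end
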